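(* Let $f:\mathbb R^d\to\mathbb R$ be differentiable and convex and attain its minimum; fix $x^\star\in\arg\min f$ and put $f^\star=f(x^\star)$, $\Delta_t=f(x_t)-f^\star$. Assume that for some $L>0$, $\|\nabla f(x)-\nabla f(y)\|\le L\|x-y\|$ for all $x,y\in\mathbb R^d$; that the oracle satisfies $\mathbb E[g_t\mid\mathcal F_{t-1}]=\nabla f(x_t)$ for all $t\ge1$; and that there are $A,B,C\ge0$ with $$\mathbb E[\|g_t\|^2\mid\mathcal F_{t-1}]\le A\Delta_t+B\|\nabla f(x_t)\|^2+C\qquad\text{for all }t\ge1.$$ Let $Q=A+2LB$. Then for every integer $T\ge1$: 1. (AdaGrad-Norm.) Let $(x_t)$ be generated by AdaGrad-Norm with $b_0,\eta>0$. If $\|x_t-x^\star\|\le D$ almost surely for all $t$, where $D\in[0,\infty)$ is independent of $t$, set $\Gamma=D^2/(2\eta)+\eta$. Then $$\mathbb E[f(\bar x_T)-f^\star]\le\frac{\Gamma^2Q+\Gamma b_0}{T}+\Gamma\sqrt{\frac CT}.$$ 2. (AdaGrad.) Let $(x_t)$ be generated by coordinate-wise AdaGrad with $b_{0,i},\eta>0$. If $|x_{t,i}-x^\star_i|\le D_i$ almost surely for all $t$ and $i$, where $D_i\in[0,\infty)$ are independent of $t$, set $\Gamma_i=D_i^2/(2\eta)+\eta$, $\Lambda=\big(\sum_{i=1}^d\Gamma_i^2\big)^{1/2}$, $\beta_0=\big(\sum_{i=1}^d b_{0,i}^2\big)^{1/2}$. Then $$\mathbb E[f(\bar x_T)-f^\star]\le\frac{\Lambda^2Q+\Lambda\beta_0}{T}+\Lambda\sqrt{\frac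 CT}.$$ In particular, $C=0$ gives $O(T^{-1})$; and if instead of the second-moment condition above one assumes bounded variance, $\mathbb E[\|g_t-\nabla f(x_t)\|^2\mid\mathcal F_{t-1}]\le\sigma^2$ for all $t\ge 1$ with some $\sigma\ge0$, then the two bounds hold with $Q=2L$ and $C=\sigma^2$, giving $O(T^{-1}+\sigma T^{-1/2})$.
   Context: Norms are Euclidean; $\bar x_T=\frac1T\sum_{t=1}^T x_t$. Subscript $i$ denotes the $i$-th coordinate. Oracle and filtration: at each time $t\ge1$, queried at $x_t$, the oracle returns a random vector $g_t=\nabla f(x_t)+\xi_t\in\mathbb R^d$; it may depend on time and history. The initialization $x_1$ is deterministic, $\mathcal F_0$ is trivial, and $\mathcal F_t=\sigma(g_1,\dots,g_t)$, so $x_t$ is $\mathcal F_{t-1}$-measurable. AdaGrad-Norm (with $b_0,\eta>0$): $b_t^2=b_0^2+\sum_{s=1}^t\|g_s\|^2$, $b_t>0$, and $x_{t+1}=x_t-\eta\, g_t/b_t$. AdaGrad (coordinate-wise, with $b_{0,i},\eta>0$): $b_{t,i}^2=b_{0,i}^2+\sum_{s=1}^t g_{s,i}^2$, $b_{t,i}>0$, and $x_{t+1,i}=x_{t,i}-\eta\, g_{t,i}/b_{t,i}$ for $1\le i\le d$. The $O(\cdot)$ constants may depend on the fixed problem and algorithm parameters but not on $T$. *)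

theory Defs
  imports "HOL-Probability.Probability"
begin

text \<open>
  Stochastic sequences are functions of type \<open>nat \<Rightarrow> 'w \<Rightarrow> real ^ 'd\<close>, where \<open>'w\<close> is the sample
  space. The iterates \<open>x\<close> and the oracle answers \<open>g\<close> are indexed by times \<open>t \<ge> 1\<close>; the values at
  index 0 play no role.
\<close>

definition oracle_filtration ::
  "'w measure \<Rightarrow> (nat \<Rightarrow> 'w \<Rightarrow> real ^ 'd) \<Rightarrow> nat \<Rightarrow> 'w measure" where
  "oracle_filtration M g t =
     sigma (space M) (\<Union>s\<in>{1..t}. {g s -` U \<inter> space M | U. U \<in> sets borel})"

text \<open>
  The noise \<open>g t - \<nabla>f (x t)\<close> is not a separate parameter. Conditional expectations of vectors are
  taken coordinatewise. The library's \<open>real_cond_exp\<close> is only meaningful for integrable functions;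
  integrability of \<open>g t\<close> is not assumed here because it follows from either of the two moment
  conditions below once the iterates are bounded almost surely.
\<close>

definition unbiased_oracle ::
  "'w measure \<Rightarrow> (real ^ 'd \<Rightarrow> real ^ 'd) \<Rightarrow> (nat \<Rightarrow> 'w \<Rightarrow> real ^ 'd) \<Rightarrow> (nat \<Rightarrow> 'w \<Rightarrow> real ^ 'd) \<Rightarrow> bool"
where
  "unbiased_oracle M grad x g \<longleftrightarrow>
     (\<forall>t\<ge>1. g t \<in> borel_measurable M) \<and>
     (\<exists>x1. \<forall>\<omega>\<in>space M. x 1 \<omega> = x1) \<and>
     (\<forall>t\<ge>1. \<forall>i. AE \<omega> in M.
        real_cond_exp M (oracle_filtration M g (t - 1)) (\<lambda>\<omega>. g t \<omega> $ i) \<omega> = grad (x t \<omega>) $ i)"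

text \<open>
  Conditional second moments use the conditional expectation of nonnegative extended reals, so that
  an infinite conditional moment is not silently replaced by 0.
\<close>

definition second_moment_bound ::
  "'w measure \<Rightarrow> (real ^ 'd \<Rightarrow> real) \<Rightarrow> (real ^ 'd \<Rightarrow> real ^ 'd) \<Rightarrow> real ^ 'd \<Rightarrow>
   real \<Rightarrow> real \<Rightarrow> real \<Rightarrow> (nat \<Rightarrow> 'w \<Rightarrow> real ^ 'd) \<Rightarrow> (nat \<Rightarrow> 'w \<Rightarrow> real ^ 'd) \<Rightarrow> bool"
where
  "second_moment_bound M f grad xs A B C x g \<longleftrightarrow>
     (\<forall>t\<ge>1. AE \<omega> in M.
        nn_cond_exp M (oracle_filtration M g (t - 1)) (\<lambda>\<omega>. ennreal ((norm (g t \<omega>))\<^sup>2)) \<omega>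
        \<le> ennreal (A * (f (x t \<omega>) - f xs) + B * (norm (grad (x t \<omega>)))\<^sup>2 + C))"

definition bounded_variance ::
  "'w measure \<Rightarrow> (real ^ 'd \<Rightarrow> real ^ 'd) \<Rightarrow> real \<Rightarrow>
   (nat \<Rightarrow> 'w \<Rightarrow> real ^ 'd) \<Rightarrow> (nat \<Rightarrow> 'w \<Rightarrow> real ^ 'd) \<Rightarrow> bool"
where
  "bounded_variance M grad \<sigma> x g \<longleftrightarrow>
     (\<forall>t\<ge>1. AE \<omega> in M.
        nn_cond_exp M (oracle_filtration M g (t - 1))
          (\<lambda>\<omega>. ennreal ((norm (g t \<omega> - grad (x t \<omega>)))\<^sup>2)) \<omega>
        \<le> ennreal (\<sigma>\<^sup>2))"

definition adagrad_norm_b :: "real \<Rightarrow> (nat \<Rightarrow> real ^ 'd) \<Rightarrow> nat \<Rightarrow> real" where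
  "adagrad_norm_b b0 g t = sqrt (b0\<^sup>2 + (\<Sum>s=1..t. (norm (g s))\<^sup>2))"

definition adagrad_norm :: "real \<Rightarrow> real \<Rightarrow> (nat \<Rightarrow> real ^ 'd) \<Rightarrow> (nat \<Rightarrow> real ^ 'd) \<Rightarrow> bool" where
  "adagrad_norm b0 \<eta> x g \<longleftrightarrow>
     (\<forall>t\<ge>1. x (t + 1) = x t - (\<eta> / adagrad_norm_b b0 g t) *\<^sub>R g t)"

definition adagrad_b :: "real ^ 'd \<Rightarrow> (nat \<Rightarrow> real ^ 'd) \<Rightarrow> nat \<Rightarrow> 'd \<Rightarrow> real" where
  "adagrad_b b0 g t i = sqrt ((b0 $ i)\<^sup>2 + (\<Sum>s=1..t. (g s $ i)\<^sup>2))"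

definition adagrad :: "real ^ 'd \<Rightarrow> real \<Rightarrow> (nat \<Rightarrow> real ^ 'd) \<Rightarrow> (nat \<Rightarrow> real ^ 'd) \<Rightarrow> bool" where
  "adagrad b0 \<eta> x g \<longleftrightarrow>
     (\<forall>t\<ge>1. \<forall>i. x (t + 1) $ i = x t $ i - \<eta> * g t $ i / adagrad_b b0 g t i)"

definition bounded_adagrad_norm_process ::
  "'w measure \<Rightarrow> (real ^ 'd \<Rightarrow> real ^ 'd) \<Rightarrow> real ^ 'd \<Rightarrow> real \<Rightarrow> real \<Rightarrow> real \<Rightarrow>
   (nat \<Rightarrow> 'w \<Rightarrow> real ^ 'd) \<Rightarrow> (nat \<Rightarrow> 'w \<Rightarrow> real ^ 'd) \<Rightarrow> bool"
where
  "bounded_adagrad_norm_process M grad xs b0 \<eta> D x g \<longleftrightarrow>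
     prob_space M \<and> unbiased_oracle M grad x g \<and>
     (\<forall>\<omega>\<in>space M. adagrad_norm b0 \<eta> (\<lambda>t. x t \<omega>) (\<lambda>t. g t \<omega>)) \<and>
     (\<forall>t\<ge>1. AE \<omega> in M. norm (x t \<omega> - xs) \<le> D)"

definition bounded_adagrad_process ::
  "'w measure \<Rightarrow> (real ^ 'd \<Rightarrow> real ^ 'd) \<Rightarrow> real ^ 'd \<Rightarrow> real ^ 'd \<Rightarrow> real \<Rightarrow> real ^ 'd \<Rightarrow>
   (nat \<Rightarrow> 'w \<Rightarrow> real ^ 'd) \<Rightarrow> (nat \<Rightarrow> 'w \<Rightarrow> real ^ 'd) \<Rightarrow> bool"
where
  "bounded_adagrad_process M grad xs b0 \<eta> D x g \<longleftrightarrow>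
     prob_space M \<and> unbiased_oracle M grad x g \<and>
     (\<forall>\<omega>\<in>space M. adagrad b0 \<eta> (\<lambda>t. x t \<omega>) (\<lambda>t. g t \<omega>)) \<and>
     (\<forall>t\<ge>1. \<forall>i. AE \<omega> in M. \<bar>x t \<omega> $ i - xs $ i\<bar> \<le> D $ i)"

definition avg_iterate :: "(nat \<Rightarrow> 'w \<Rightarrow> real ^ 'd) \<Rightarrow> nat \<Rightarrow> 'w \<Rightarrow> real ^ 'd" where
  "avg_iterate x T \<omega> = (1 / real T) *\<^sub>R (\<Sum>t=1..T. x t \<omega>)"

text \<open>
  Integrability is part of the claim, since the Bochner integral of a non-integrable function is 0.
\<close>

definition expected_gap_le ::
  "'w measure \<Rightarrow> (real ^ 'd \<Rightarrow> real) \<Rightarrow> real ^ 'd \<Rightarrow> (nat \<Rightarrow> 'w \<Rightarrow> real ^ 'd) \<Rightarrow> nat \<Rightarrow> real \<Rightarrow> bool"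
where
  "expected_gap_le M f xs x T r \<longleftrightarrow>
     integrable M (\<lambda>\<omega>. f (avg_iterate x T \<omega>) - f xs) \<and>
     (\<integral>\<omega>. (f (avg_iterate x T \<omega>) - f xs) \<partial>M) \<le> r"

end

theory Submission
  imports Defs
begin

text \<open>
  Both algorithms obey the same pathwise regret bound, and beyond it the argument uses only that
  the iterates are bounded and determined by the past: for almost every run
  \[ \sum_{t \le T} \langle g_t, x_t - x^\star \rangle
       \le \Gamma \sqrt{\beta^2 + \sum_{t \le T} \|g_t\|^2} , \]
  with \<open>\<beta>\<close> the norm of the initial accumulator. This is lemma \<open>adagrad_regret\<close>, an
  analysis of one adaptive step size in any real inner product space. AdaGrad-Norm applies it to
  the whole vector. Coordinate-wise AdaGrad applies it to each coordinate, that is, on the real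
  line, and Cauchy-Schwarz over the coordinates turns \<open>\<Sum>i. \<Gamma>\<^sub>i b\<^sub>T\<^sub>,\<^sub>i\<close> into
  \<open>\<Lambda>\<close> times the Euclidean norm of the accumulators.

  Let \<open>S\<close> be the sum over \<open>t \<le> T\<close> of the expected gaps. By convexity and since the
  oracle is unbiased given the past, \<open>S\<close> is at most the expected left-hand side
  (\<open>expectation_inner_oracle\<close>). By Jensen, the expected right-hand side is at most
  \<open>\<Gamma>\<close> times the root of \<open>\<beta>\<^sup>2\<close> plus the sum of the expected squared norms of the
  answers. For an \<open>L\<close>-smooth function \<open>\<parallel>grad x\<parallel>\<^sup>2 \<le> 2 L (f x - f xs)\<close>, so that last sum
  is at most \<open>Q S + C T\<close>. The bound is thus self-referential,
  \[ S \le \Gamma \sqrt{\beta^2 + Q S + C T} , \]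
  and solving this quadratic inequality (\<open>quadratic_inequality_bound\<close>) gives
  \<open>S \<le> \<Gamma>\<^sup>2 Q + \<Gamma> \<beta> + \<Gamma> sqrt (C T)\<close>. Dividing by \<open>T\<close> and applying convexity to the averaged
  iterate yields the claim.

  Under bounded variance, unbiasedness removes the cross term, so the expected squared norm of an
  answer is at most that of the gradient plus \<open>\<sigma>\<^sup>2\<close>. This is the integrated moment condition with
  \<open>A = 0\<close>, \<open>B = 1\<close> and \<open>C = \<sigma>\<^sup>2\<close>, hence \<open>Q = 2 L\<close>. For this reason the expectation argument
  (\<open>expected_gap_le_of_regret\<close>) starts from the integrated condition.
\<close>

section \<open>Pathwise regret of adaptive step sizes\<close>

text \<open>
  Multiplying the expanded square of the step by \<open>b t / (2 * \<eta>)\<close> expresses \<open>g t \<bullet> (x t - u)\<close>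
  through a weighted difference of squared distances plus \<open>\<eta> / 2 * (norm (g t))\<^sup>2 / b t\<close>. Since
  the weights \<open>b t\<close> increase, summation by parts bounds the first part by
  \<open>D\<^sup>2 / (2 * \<eta>) * b T\<close>. The second part telescopes, because \<open>(norm (g t))\<^sup>2\<close> is a difference of
  consecutive squares of \<open>b\<close>, hence at most \<open>2 * b t\<close> times the increment of \<open>b\<close>.
\<close>

lemma adagrad_regret:
  fixes x g :: "nat \<Rightarrow> 'a::real_inner" and u :: 'a and b :: "nat \<Rightarrow> real"
  assumes b_pos: "\<And>t. 0 < b t"
    and b_step: "\<And>t. (b (Suc t))\<^sup>2 = (b t)\<^sup>2 + (norm (g (Suc t)))\<^sup>2"
    and x_step: "\<And>t. 1 \<le> t \<Longrightarrow> x (Suc t) = x t - (\<eta> / b t) *\<^sub>R g t"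
    and bounded: "\<And>t. 1 \<le> t \<Longrightarrow> norm (x t - u) \<le> D"
    and "0 < \<eta>"
  shows "(\<Sum>t=1..T. g t \<bullet> (x t - u)) \<le> (D\<^sup>2 / (2 * \<eta>) + \<eta>) * b T"
proof -
  define d where "d t = (norm (x t - u))\<^sup>2" for t
  have d_le: "d (Suc t) \<le> D\<^sup>2" for t
    unfolding d_def using bounded[of "Suc t"] by (simp add: power_mono)
  \<comment> \<open>Keeping the distance term on the left does the summation by parts within the induction.\<close>
  have "(\<Sum>t=1..T. g t \<bullet> (x t - u)) + b T / (2 * \<eta>) * d (Suc T)
      \<le> D\<^sup>2 / (2 * \<eta>) * b T + \<eta> * (b T - b 0)"
  proof (induction T)
    case 0
    have "b 0 / (2 * \<eta>) * d (Suc 0) \<le> b 0 / (2 * \<eta>) * D\<^sup>2"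
      by (rule mult_left_mono[OF d_le]) (use b_pos[of 0] \<open>0 < \<eta>\<close> in simp)
    then show ?case by (simp add: mult.commute)
  next
    case (Suc T)
    define G where "G = (norm (g (Suc T)))\<^sup>2"
    define p where "p = g (Suc T) \<bullet> (x (Suc T) - u)"
    note pos = b_pos[of T] b_pos[of "Suc T"]
    have G: "G = (b (Suc T) - b T) * (b (Suc T) + b T)"
      using b_step[of T] by (simp add: G_def power2_eq_square algebra_simps)
    have mono: "b T \<le> b (Suc T)"
      by (rule power2_le_imp_le) (use b_step[of T] pos in auto)
    have "d (Suc (Suc T)) = (norm ((x (Suc T) - u) - (\<eta> / b (Suc T)) *\<^sub>R g (Suc T)))\<^sup>2"
      using x_step[of "Suc T"] by (simp add: d_def diff_diff_eq add.commute)
    also have "\<dots> = d (Suc T) - 2 * (\<eta> / b (Suc T)) * p + (\<eta> / b (Suc T))\<^sup>2 * G"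
      unfolding d_def p_def G_def power2_norm_eq_inner
      by (simp add: inner_diff_left inner_diff_right inner_commute power2_eq_square algebra_simps)
    finally have d_step: "b (Suc T) / (2 * \<eta>) * d (Suc (Suc T))
        = b (Suc T) / (2 * \<eta>) * d (Suc T) - p + \<eta> / 2 * (G / b (Suc T))"
      using pos \<open>0 < \<eta>\<close> by (simp add: field_simps power2_eq_square)
    have "G / b (Suc T) \<le> 2 * (b (Suc T) - b T)"
    proof -
      have "G \<le> (b (Suc T) - b T) * (2 * b (Suc T))"
        unfolding G by (rule mult_left_mono) (use mono in auto)
      then show ?thesis using pos by (simp add: field_simps)
    qed
    then have "\<eta> / 2 * (G / b (Suc T)) \<le> \<eta> / 2 * (2 * (b (Suc T) - b T))"
      by (rule mult_left_mono) (use \<open>0 < \<eta>\<close> in simp)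
    moreover have "(b (Suc T) - b T) / (2 * \<eta>) * d (Suc T) \<le> (b (Suc T) - b T) / (2 * \<eta>) * D\<^sup>2"
      by (rule mult_left_mono[OF d_le]) (use mono \<open>0 < \<eta>\<close> in simp)
    ultimately show ?case
      using Suc.IH d_step by (simp add: p_def algebra_simps diff_divide_distrib)
  qed
  moreover have "0 \<le> b T / (2 * \<eta>) * d (Suc T)"
    using b_pos[of T] \<open>0 < \<eta>\<close> by (simp add: d_def)
  moreover have "0 \<le> \<eta> * b 0"
    using b_pos[of 0] \<open>0 < \<eta>\<close> by simp
  ultimately show ?thesis by (simp add: algebra_simps)
qed

lemma adagrad_norm_regret:
  assumes "adagrad_norm b0 \<eta> x g" "0 < b0" "0 < \<eta>"
    and "\<And>t. 1 \<le> t \<Longrightarrow> norm (x t - u) \<le> D"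
  shows "(\<Sum>t=1..T. g t \<bullet> (x t - u))
      \<le> (D\<^sup>2 / (2 * \<eta>) + \<eta>) * sqrt (b0\<^sup>2 + (\<Sum>t=1..T. (norm (g t))\<^sup>2))"
proof -
  have pos: "0 < b0\<^sup>2 + (\<Sum>s=1..t. (norm (g s))\<^sup>2)" for t
    using \<open>0 < b0\<close> by (intro add_pos_nonneg sum_nonneg) auto
  have "(\<Sum>t=1..T. g t \<bullet> (x t - u)) \<le> (D\<^sup>2 / (2 * \<eta>) + \<eta>) * adagrad_norm_b b0 g T"
  proof (rule adagrad_regret)
    show "0 < adagrad_norm_b b0 g t" for t
      using pos by (simp add: adagrad_norm_b_def)
    show "(adagrad_norm_b b0 g (Suc t))\<^sup>2 = (adagrad_norm_b b0 g t)\<^sup>2 + (norm (g (Suc t)))\<^sup>2" for t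
      using pos[of t] pos[of "Suc t"] by (simp add: adagrad_norm_b_def)
    show "x (Suc t) = x t - (\<eta> / adagrad_norm_b b0 g t) *\<^sub>R g t" if "1 \<le> t" for t
      using assms(1) that by (simp add: adagrad_norm_def)
  qed (use assms in auto)
  then show ?thesis by (simp add: adagrad_norm_b_def)
qed

text \<open>
  Each coordinate is a run on the real line with its own accumulator. The factor \<open>\<Lambda>\<close> and the joint
  accumulator come from Cauchy-Schwarz; the initial value is written as the square of a square root
  so that the right-hand side has the same form as for AdaGrad-Norm.
\<close>

lemma adagrad_coordinatewise_regret:
  fixes x g :: "nat \<Rightarrow> real ^ 'd" and u b0 D :: "real ^ 'd"
  assumes "adagrad b0 \<eta> x g" "\<And>i. 0 < b0 $ i" "0 < \<eta>"
    and "\<And>t i. 1 \<le> t \<Longrightarrow> \<bar>x t $ i - u $ i\<bar> \<le> D $ i"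
  shows "(\<Sum>t=1..T. g t \<bullet> (x t - u))
      \<le> sqrt (\<Sum>i\<in>UNIV. ((D $ i)\<^sup>2 / (2 * \<eta>) + \<eta>)\<^sup>2)
        * sqrt ((sqrt (\<Sum>i\<in>UNIV. (b0 $ i)\<^sup>2))\<^sup>2 + (\<Sum>t=1..T. (norm (g t))\<^sup>2))"
proof -
  define \<Gamma> where "\<Gamma> i = (D $ i)\<^sup>2 / (2 * \<eta>) + \<eta>" for i
  have pos: "0 < (b0 $ i)\<^sup>2 + (\<Sum>s=1..t. (g s $ i)\<^sup>2)" for t i
    using assms(2)[of i] by (intro add_pos_nonneg sum_nonneg) auto
  have coord: "(\<Sum>t=1..T. g t $ i \<bullet> (x t $ i - u $ i)) \<le> \<Gamma> i * adagrad_b b0 g T i" for i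
    unfolding \<Gamma>_def
  proof (rule adagrad_regret)
    show "0 < adagrad_b b0 g t i" for t
      using pos by (simp add: adagrad_b_def)
    show "(adagrad_b b0 g (Suc t) i)\<^sup>2 = (adagrad_b b0 g t i)\<^sup>2 + (norm (g (Suc t) $ i))\<^sup>2" for t
      using pos[of i t] pos[of i "Suc t"] by (simp add: adagrad_b_def)
    show "x (Suc t) $ i = x t $ i - (\<eta> / adagrad_b b0 g t i) *\<^sub>R g t $ i" if "1 \<le> t" for t
      using assms(1) that by (simp add: adagrad_def)
  qed (use assms in auto)
  have "(\<Sum>t=1..T. g t \<bullet> (x t - u)) = (\<Sum>i\<in>UNIV. \<Sum>t=1..T. g t $ i \<bullet> (x t $ i - u $ i))"
    unfolding inner_vec_def by (subst sum.swap) simp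
  also have "\<dots> \<le> (\<Sum>i\<in>UNIV. \<bar>\<Gamma> i\<bar> * \<bar>adagrad_b b0 g T i\<bar>)"
  proof (rule sum_mono)
    fix i
    show "(\<Sum>t=1..T. g t $ i \<bullet> (x t $ i - u $ i)) \<le> \<bar>\<Gamma> i\<bar> * \<bar>adagrad_b b0 g T i\<bar>"
      using coord[of i] abs_ge_self[of "\<Gamma> i * adagrad_b b0 g T i"] by (simp only: abs_mult)
  qed
  also have "\<dots> \<le> L2_set \<Gamma> UNIV * L2_set (adagrad_b b0 g T) UNIV"
    by (rule L2_set_mult_ineq)
  also have "L2_set (adagrad_b b0 g T) UNIV
      = sqrt ((\<Sum>i\<in>UNIV. (b0 $ i)\<^sup>2) + (\<Sum>t=1..T. \<Sum>i\<in>UNIV. (g t $ i)\<^sup>2))"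
    unfolding L2_set_def adagrad_b_def real_sqrt_pow2[OF less_imp_le[OF pos]] sum.distrib
    by (simp only: sum.swap[of _ UNIV])
  also have "(\<Sum>t=1..T. \<Sum>i\<in>UNIV. (g t $ i)\<^sup>2) = (\<Sum>t=1..T. (norm (g t))\<^sup>2)"
    unfolding power2_norm_eq_inner inner_vec_def by (simp add: power2_eq_square)
  finally show ?thesis by (simp add: L2_set_def \<Gamma>_def sum_nonneg)
qed

section \<open>Solving the self-referential bound\<close>

text \<open>
  Put \<open>c = \<Gamma> * \<beta> + \<Gamma> * sqrt (C * T)\<close>. Squaring gives \<open>S * (S - \<Gamma>\<^sup>2 * Q) \<le> c\<^sup>2\<close>, while
  \<open>S > \<Gamma>\<^sup>2 * Q + c\<close> would make both factors exceed \<open>c\<close>. No square root of a discriminant appears,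
  so the term \<open>\<Gamma>\<^sup>2 * Q\<close> keeps the constant 1.
\<close>

lemma quadratic_inequality_bound:
  fixes S :: real
  assumes "S \<le> \<Gamma> * sqrt (\<beta>\<^sup>2 + (Q * S + C * T))"
    and "0 \<le> S" "0 \<le> \<Gamma>" "0 \<le> \<beta>" "0 \<le> Q" "0 \<le> C" "0 \<le> T"
  shows "S \<le> \<Gamma>\<^sup>2 * Q + \<Gamma> * \<beta> + \<Gamma> * sqrt (C * T)"
proof (rule ccontr)
  define c where "c = \<Gamma> * \<beta> + \<Gamma> * sqrt (C * T)"
  assume "\<not> ?thesis"
  then have S: "\<Gamma>\<^sup>2 * Q + c < S" by (simp add: c_def)
  have c: "0 \<le> c" using assms by (simp add: c_def)
  have "S\<^sup>2 \<le> (\<Gamma> * sqrt (\<beta>\<^sup>2 + (Q * S + C * T)))\<^sup>2"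
    using assms(1,2) by (rule power_mono)
  also have "\<dots> = \<Gamma>\<^sup>2 * (\<beta>\<^sup>2 + (Q * S + C * T))"
    using assms by (simp add: power_mult_distrib)
  finally have upper: "S * (S - \<Gamma>\<^sup>2 * Q) \<le> \<Gamma>\<^sup>2 * \<beta>\<^sup>2 + \<Gamma>\<^sup>2 * (C * T)"
    by (simp add: power2_eq_square algebra_simps)
  have "c\<^sup>2 = (\<Gamma> * \<beta>)\<^sup>2 + (\<Gamma> * sqrt (C * T))\<^sup>2 + 2 * (\<Gamma> * \<beta>) * (\<Gamma> * sqrt (C * T))"
    by (simp add: c_def power2_sum)
  moreover have "0 \<le> 2 * (\<Gamma> * \<beta>) * (\<Gamma> * sqrt (C * T))"
    using assms by (intro mult_nonneg_nonneg) auto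
  moreover have "(\<Gamma> * sqrt (C * T))\<^sup>2 = \<Gamma>\<^sup>2 * (C * T)"
    using assms by (simp add: power_mult_distrib)
  moreover have "(\<Gamma> * \<beta>)\<^sup>2 = \<Gamma>\<^sup>2 * \<beta>\<^sup>2"
    by (rule power_mult_distrib)
  ultimately have "\<Gamma>\<^sup>2 * \<beta>\<^sup>2 + \<Gamma>\<^sup>2 * (C * T) \<le> c\<^sup>2"
    by linarith
  moreover have "c * c < S * (S - \<Gamma>\<^sup>2 * Q)"
  proof -
    have "0 \<le> \<Gamma>\<^sup>2 * Q" using assms by simp
    then show ?thesis using S c by (intro mult_strict_mono) auto
  qed
  ultimately show False using upper by (simp add: power2_eq_square)
qed

section \<open>Smooth convex functions\<close>

locale smooth_convex_minimization =
  fixes f :: "'a::real_inner \<Rightarrow> real" and grad :: "'a \<Rightarrow> 'a" and xs :: 'a and L :: real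
  assumes gradient: "GDERIV f x :> grad x"
    and convex: "convex_on UNIV f"
    and minimizer: "f xs \<le> f y"
    and L_pos: "0 < L"
    and smooth: "norm (grad x - grad y) \<le> L * norm (x - y)"
begin

lemma DERIV_along_line: "((\<lambda>s. f (x + s *\<^sub>R v)) has_real_derivative v \<bullet> grad (x + s *\<^sub>R v)) (at s)"
proof -
  have "((\<lambda>s. x + s *\<^sub>R v) has_derivative (\<lambda>h. h *\<^sub>R v)) (at s)"
    by (auto intro!: derivative_eq_intros)
  from has_derivative_compose[OF this gradient[unfolded gderiv_def]]
  show ?thesis by (simp add: has_field_derivative_def mult_commute_abs)
qed

text \<open>
  By convexity the difference quotients of \<open>f\<close> from \<open>x\<close> towards \<open>y\<close> are at most \<open>f y - f x\<close>; they
  tend to the directional derivative.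
\<close>

lemma above_tangent: "f x + grad x \<bullet> (y - x) \<le> f y"
proof -
  let ?\<phi> = "\<lambda>s. f (x + s *\<^sub>R (y - x))"
  have "((\<lambda>h. (?\<phi> (0 + h) - ?\<phi> 0) / h) \<longlongrightarrow> (y - x) \<bullet> grad x) (at 0)"
    using DERIV_along_line[of x "y - x" 0] by (simp add: DERIV_def)
  then have lim: "((\<lambda>h. (?\<phi> (0 + h) - ?\<phi> 0) / h) \<longlongrightarrow> (y - x) \<bullet> grad x) (at_right 0)"
    by (rule filterlim_mono) (auto simp: at_le)
  have "(?\<phi> (0 + h) - ?\<phi> 0) / h \<le> f y - f x" if "0 < h" "h < 1" for h
  proof -
    have "f ((1 - h) *\<^sub>R x + h *\<^sub>R y) \<le> (1 - h) * f x + h * f y"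
      using convex_onD[OF convex, of h x y] that by simp
    moreover have "(1 - h) *\<^sub>R x + h *\<^sub>R y = x + h *\<^sub>R (y - x)"
      by (simp add: algebra_simps)
    ultimately show ?thesis using that by (simp add: field_simps)
  qed
  then have "\<forall>\<^sub>F h in at_right 0. (?\<phi> (0 + h) - ?\<phi> 0) / h \<le> f y - f x"
    using eventually_at_right_real[of 0 1] by (auto elim!: eventually_mono)
  from tendsto_upperbound[OF lim this] show ?thesis
    by (simp add: inner_commute)
qed

text \<open>
  Along the segment, \<open>f\<close> minus the claimed quadratic bound has nonpositive derivative, since the
  gradient varies by at most \<open>L * s * norm v\<close>.
\<close>

lemma descent: "f (x + v) \<le> f x + grad x \<bullet> v + L / 2 * (norm v)\<^sup>2"
proof -
  let ?\<psi> = "\<lambda>s. f (x + s *\<^sub>R v) - s * (grad x \<bullet> v) - s\<^sup>2 * (L / 2 * (norm v)\<^sup>2)"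
  have "?\<psi> 1 \<le> ?\<psi> 0"
  proof (rule DERIV_nonpos_imp_nonincreasing[where f = ?\<psi> and a = 0 and b = 1])
    fix s :: real assume "0 \<le> s"
    have "(?\<psi> has_real_derivative
        v \<bullet> grad (x + s *\<^sub>R v) - grad x \<bullet> v - s * (L * (norm v)\<^sup>2)) (at s)"
      by (rule derivative_eq_intros DERIV_along_line refl | simp)+
    moreover have "v \<bullet> grad (x + s *\<^sub>R v) - grad x \<bullet> v \<le> s * (L * (norm v)\<^sup>2)"
    proof -
      have "v \<bullet> grad (x + s *\<^sub>R v) - grad x \<bullet> v = v \<bullet> (grad (x + s *\<^sub>R v) - grad x)"
        by (simp add: inner_diff_right inner_commute)
      also have "\<dots> \<le> norm v * norm (grad (x + s *\<^sub>R v) - grad x)"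
        by (rule norm_cauchy_schwarz)
      also have "\<dots> \<le> norm v * (L * norm (s *\<^sub>R v))"
        using smooth[of "x + s *\<^sub>R v" x] by (intro mult_left_mono) auto
      finally show ?thesis using \<open>0 \<le> s\<close> by (simp add: power2_eq_square mult_ac)
    qed
    ultimately show "\<exists>y. (?\<psi> has_real_derivative y) (at s) \<and> y \<le> 0" by fastforce
  qed simp
  then show ?thesis by simp
qed

text \<open>
  A gradient step of length \<open>1 / L\<close> decreases \<open>f\<close> by at least \<open>(norm (grad x))\<^sup>2 / (2 * L)\<close>, and
  the result is still above the minimum.
\<close>

lemma norm_grad_square_le_gap: "(norm (grad x))\<^sup>2 \<le> 2 * L * (f x - f xs)"
proof -
  have "f xs \<le> f (x + (- (1 / L)) *\<^sub>R grad x)" by (rule minimizer)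
  also have "\<dots> \<le> f x - (norm (grad x))\<^sup>2 / (2 * L)"
    using descent[of x "(- (1 / L)) *\<^sub>R grad x"] L_pos
    by (simp add: power2_norm_eq_inner[symmetric] power_mult_distrib power_divide)
       (simp add: field_simps power2_eq_square)
  finally show ?thesis using L_pos by (simp add: field_simps)
qed

text \<open>
  The previous bound forces the gradient to vanish at \<open>xs\<close>.
\<close>

lemma norm_grad_le: "norm (grad x) \<le> L * norm (x - xs)"
  using smooth[of x xs] norm_grad_square_le_gap[of xs] by simp

lemma gap_le_inner: "f x - f xs \<le> grad x \<bullet> (x - xs)"
  using above_tangent[of x xs] by (simp add: inner_diff_right)

lemma continuous_grad: "continuous_on UNIV grad"
proof (rule lipschitz_on_continuous_on)
  show "L-lipschitz_on UNIV grad"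
    using smooth L_pos by (auto simp: lipschitz_on_def dist_norm)
qed

lemma continuous_f: "continuous_on UNIV f"
  using has_derivative_continuous[OF gradient[unfolded gderiv_def]]
  by (simp add: continuous_on_eq_continuous_at)

end

section \<open>Expectations, conditional moments and the oracle filtration\<close>

text \<open>
  Jensen for the square root, here from nonnegativity of the variance of \<open>sqrt Y\<close>.
\<close>

lemma (in prob_space) expectation_sqrt_le:
  assumes Y: "integrable M Y" and nonneg: "\<And>\<omega>. 0 \<le> Y \<omega>"
  shows "integrable M (\<lambda>\<omega>. sqrt (Y \<omega>))" "expectation (\<lambda>\<omega>. sqrt (Y \<omega>)) \<le> sqrt (expectation Y)"
proof -
  have meas: "(\<lambda>\<omega>. sqrt (Y \<omega>)) \<in> borel_measurable M"
    using Y by measurable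
  have square: "integrable M (\<lambda>\<omega>. (sqrt (Y \<omega>))\<^sup>2)"
    using Y nonneg by simp
  show int: "integrable M (\<lambda>\<omega>. sqrt (Y \<omega>))"
    using square_integrable_imp_integrable[OF meas square] .
  have "(expectation (\<lambda>\<omega>. sqrt (Y \<omega>)))\<^sup>2 \<le> expectation Y"
    using variance_eq[OF int square] variance_positive[of "\<lambda>\<omega>. sqrt (Y \<omega>)"] nonneg by simp
  then show "expectation (\<lambda>\<omega>. sqrt (Y \<omega>)) \<le> sqrt (expectation Y)"
    by (rule real_le_rsqrt)
qed

text \<open>
  Integrability of \<open>h\<close> is part of the conclusion: the conditional expectation is extended
  nonnegative, so the tower property holds before anything is known to be finite. This is how the
  moment conditions make the oracle answers square-integrable.
\<close>

lemma (in sigma_finite_subalgebra) integral_le_of_nn_cond_exp_le: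
  fixes h k :: "'a \<Rightarrow> real"
  assumes h: "h \<in> borel_measurable M" "\<And>\<omega>. 0 \<le> h \<omega>"
    and k: "integrable M k" "\<And>\<omega>. 0 \<le> k \<omega>"
    and le: "AE \<omega> in M. nn_cond_exp M F (\<lambda>\<omega>. ennreal (h \<omega>)) \<omega> \<le> ennreal (k \<omega>)"
  shows "integrable M h" "(\<integral>\<omega>. h \<omega> \<partial>M) \<le> (\<integral>\<omega>. k \<omega> \<partial>M)"
proof -
  have "(\<integral>\<^sup>+\<omega>. ennreal (h \<omega>) \<partial>M) = (\<integral>\<^sup>+\<omega>. nn_cond_exp M F (\<lambda>\<omega>. ennreal (h \<omega>)) \<omega> \<partial>M)"
    using nn_cond_exp_intg[of "\<lambda>_. 1" "\<lambda>\<omega>. ennreal (h \<omega>)"] h(1) by simp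
  also have "\<dots> \<le> (\<integral>\<^sup>+\<omega>. ennreal (k \<omega>) \<partial>M)"
    by (rule nn_integral_mono_AE[OF le])
  also have "\<dots> = ennreal (\<integral>\<omega>. k \<omega> \<partial>M)"
    using k by (intro nn_integral_eq_integral) auto
  finally have le': "(\<integral>\<^sup>+\<omega>. ennreal (h \<omega>) \<partial>M) \<le> ennreal (\<integral>\<omega>. k \<omega> \<partial>M)" .
  show int: "integrable M h"
    by (rule integrableI_nonneg) (use h le' in \<open>auto simp: le_less_trans\<close>)
  have "ennreal (\<integral>\<omega>. h \<omega> \<partial>M) \<le> ennreal (\<integral>\<omega>. k \<omega> \<partial>M)"
    using le' nn_integral_eq_integral[OF int] h(2) by simp
  then show "(\<integral>\<omega>. h \<omega> \<partial>M) \<le> (\<integral>\<omega>. k \<omega> \<partial>M)"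
    using k by (simp add: ennreal_le_iff integral_nonneg_AE)
qed

lemma space_oracle_filtration [simp]: "space (oracle_filtration M g t) = space M"
  by (simp add: oracle_filtration_def space_measure_of_conv)

lemma sets_oracle_filtration:
  "sets (oracle_filtration M g t) =
    sigma_sets (space M) (\<Union>s\<in>{1..t}. {g s -` U \<inter> space M | U. U \<in> sets borel})"
  unfolding oracle_filtration_def by (rule sets_measure_of) auto

lemma subalgebra_oracle_filtration:
  assumes "\<And>t. 1 \<le> t \<Longrightarrow> g t \<in> borel_measurable M"
  shows "subalgebra M (oracle_filtration M g t)"
proof -
  have "sigma_sets (space M) (\<Union>s\<in>{1..t}. {g s -` U \<inter> space M | U. U \<in> sets borel}) \<subseteq> sets M"
    by (rule sets.sigma_sets_subset) (use assms in \<open>auto intro: measurable_sets\<close>)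
  then show ?thesis by (simp add: subalgebra_def sets_oracle_filtration)
qed

lemma oracle_filtration_mono:
  assumes "s \<le> t"
  shows "subalgebra (oracle_filtration M g t) (oracle_filtration M g s)"
proof -
  have "sets (oracle_filtration M g s) \<subseteq> sets (oracle_filtration M g t)"
    unfolding sets_oracle_filtration by (rule sigma_sets_mono') (use assms in fastforce)
  then show ?thesis by (simp add: subalgebra_def)
qed

lemma measurable_oracle_filtration:
  fixes g :: "nat \<Rightarrow> 'w \<Rightarrow> real ^ 'd"
  assumes "1 \<le> s" "s \<le> t"
  shows "g s \<in> borel_measurable (oracle_filtration M g t)"
proof (rule measurableI)
  fix U :: "(real ^ 'd) set" assume "U \<in> sets borel"
  then show "g s -` U \<inter> space (oracle_filtration M g t) \<in> sets (oracle_filtration M g t)"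
    unfolding sets_oracle_filtration space_oracle_filtration
    using assms by (intro sigma_sets.Basic) fastforce
qed simp

lemma borel_measurable_vec_nth [measurable]:
  "(\<lambda>v::real ^ 'd. v $ i) \<in> borel_measurable borel"
  by (intro borel_measurable_continuous_onI continuous_intros)

lemma borel_measurable_vecI:
  fixes h :: "'w \<Rightarrow> real ^ 'd"
  assumes "\<And>i. (\<lambda>\<omega>. h \<omega> $ i) \<in> borel_measurable N"
  shows "h \<in> borel_measurable N"
  using assms by (subst borel_measurable_euclidean_space) (auto simp: Basis_vec_def inner_axis)

text \<open>
  The common part of both algorithms: the initial point is deterministic and each update depends
  only on the answers received so far.
\<close>

lemma adapted_iterates:
  fixes x g :: "nat \<Rightarrow> 'w \<Rightarrow> real ^ 'd"
  assumes init: "\<And>\<omega>. \<omega> \<in> space M \<Longrightarrow> x 1 \<omega> = start"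
    and step: "\<And>t \<omega>. 1 \<le> t \<Longrightarrow> \<omega> \<in> space M \<Longrightarrow> x (Suc t) \<omega> = x t \<omega> - u t \<omega>"
    and u: "\<And>t. 1 \<le> t \<Longrightarrow> u t \<in> borel_measurable (oracle_filtration M g t)"
    and "1 \<le> t"
  shows "x t \<in> borel_measurable (oracle_filtration M g (t - 1))"
  using \<open>1 \<le> t\<close>
proof (induction t rule: dec_induct)
  case base
  have "x 1 \<in> borel_measurable (oracle_filtration M g 0) \<longleftrightarrow>
      (\<lambda>_. start) \<in> borel_measurable (oracle_filtration M g 0)"
    by (rule measurable_cong) (simp add: init[simplified])
  then show ?case by simp
next
  case (step t)
  have "x t \<in> borel_measurable (oracle_filtration M g t)"
    by (rule measurable_from_subalg[OF oracle_filtration_mono step.IH]) simp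
  then have "(\<lambda>\<omega>. x t \<omega> - u t \<omega>) \<in> borel_measurable (oracle_filtration M g t)"
    using u[OF \<open>1 \<le> t\<close>] by (rule borel_measurable_diff)
  moreover have "x (Suc t) \<in> borel_measurable (oracle_filtration M g t) \<longleftrightarrow>
      (\<lambda>\<omega>. x t \<omega> - u t \<omega>) \<in> borel_measurable (oracle_filtration M g t)"
    by (rule measurable_cong) (use assms(2) \<open>1 \<le> t\<close> in simp)
  ultimately show ?case by simp
qed

lemma measurable_adagrad_norm_step:
  assumes "1 \<le> t"
  shows "(\<lambda>\<omega>. (\<eta> / adagrad_norm_b b0 (\<lambda>t. g t \<omega>) t) *\<^sub>R g t \<omega>) \<in> borel_measurable (oracle_filtration M g t)"
proof -
  have g: "g s \<in> borel_measurable (oracle_filtration M g t)" if "s \<in> {1..t}" for s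
    using that by (intro measurable_oracle_filtration) auto
  have [measurable]: "g t \<in> borel_measurable (oracle_filtration M g t)"
    using assms g by simp
  have [measurable]: "(\<lambda>\<omega>. \<Sum>s=1..t. (norm (g s \<omega>))\<^sup>2) \<in> borel_measurable (oracle_filtration M g t)"
    by (intro borel_measurable_sum borel_measurable_power
        measurable_compose[OF g borel_measurable_continuous_onI[OF continuous_on_norm_id]])
  show ?thesis unfolding adagrad_norm_b_def by measurable
qed

lemma measurable_adagrad_step:
  fixes g :: "nat \<Rightarrow> 'w \<Rightarrow> real ^ 'd"
  assumes "1 \<le> t"
  shows "(\<lambda>\<omega>. \<chi> i. \<eta> * g t \<omega> $ i / adagrad_b b0 (\<lambda>t. g t \<omega>) t i)
      \<in> borel_measurable (oracle_filtration M g t)"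
proof (rule borel_measurable_vecI)
  fix i
  have g: "(\<lambda>\<omega>. g s \<omega> $ i) \<in> borel_measurable (oracle_filtration M g t)" if "s \<in> {1..t}" for s
    using that by (intro measurable_compose[OF measurable_oracle_filtration borel_measurable_vec_nth]) auto
  have [measurable]: "(\<lambda>\<omega>. g t \<omega> $ i) \<in> borel_measurable (oracle_filtration M g t)"
    using assms g by simp
  have [measurable]: "(\<lambda>\<omega>. \<Sum>s=1..t. (g s \<omega> $ i)\<^sup>2) \<in> borel_measurable (oracle_filtration M g t)"
    by (intro borel_measurable_sum borel_measurable_power g)
  show "(\<lambda>\<omega>. (\<chi> i. \<eta> * g t \<omega> $ i / adagrad_b b0 (\<lambda>t. g t \<omega>) t i) $ i)
      \<in> borel_measurable (oracle_filtration M g t)"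
    unfolding adagrad_b_def vec_lambda_beta by measurable
qed

section \<open>Expected gap of a bounded run\<close>

text \<open>
  Used to pass from a square-integrable noise to a square-integrable oracle answer.
\<close>

lemma norm_square_le_twice:
  fixes a b :: "'a::real_inner"
  shows "(norm a)\<^sup>2 \<le> 2 * (norm (a - b))\<^sup>2 + 2 * (norm b)\<^sup>2"
proof -
  have "(norm (a - b - b))\<^sup>2 = 2 * (norm (a - b))\<^sup>2 + 2 * (norm b)\<^sup>2 - (norm a)\<^sup>2"
    unfolding power2_norm_eq_inner by (simp add: inner_diff_left inner_diff_right inner_commute)
  then show ?thesis by (metis diff_ge_0_iff_ge zero_le_power2)
qed

text \<open>
  What the expectation argument needs to know about a run. The radius \<open>R\<close> makes gaps and
  gradients integrable; the rates come from the regret bound of the algorithm.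
\<close>

locale bounded_oracle_process =
  smooth_convex_minimization f grad xs L + prob_space M
  for f :: "real ^ 'd \<Rightarrow> real" and grad xs L and M :: "'w measure" +
  fixes x g :: "nat \<Rightarrow> 'w \<Rightarrow> real ^ 'd" and R :: real
  assumes unbiased: "unbiased_oracle M grad x g"
    and adapted: "1 \<le> t \<Longrightarrow> x t \<in> borel_measurable (oracle_filtration M g (t - 1))"
    and bounded: "1 \<le> t \<Longrightarrow> AE \<omega> in M. norm (x t \<omega> - xs) \<le> R"
begin

abbreviation \<F> :: "nat \<Rightarrow> 'w measure" where
  "\<F> t \<equiv> oracle_filtration M g (t - 1)"

lemma measurable_g: "1 \<le> t \<Longrightarrow> g t \<in> borel_measurable M"
  using unbiased by (simp add: unbiased_oracle_def)

lemma subalgebra_\<F>: "subalgebra M (\<F> t)"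
  by (rule subalgebra_oracle_filtration) (rule measurable_g)

sublocale past: finite_measure_subalgebra M "\<F> t" for t
  by unfold_locales (rule subalgebra_\<F>)

lemma measurable_x: "1 \<le> t \<Longrightarrow> x t \<in> borel_measurable M"
  by (rule measurable_from_subalg[OF subalgebra_\<F> adapted])

lemma measurable_grad_x: "1 \<le> t \<Longrightarrow> (\<lambda>\<omega>. grad (x t \<omega>)) \<in> borel_measurable (\<F> t)"
  by (rule borel_measurable_continuous_on[OF continuous_grad adapted])

lemma measurable_grad_x': "1 \<le> t \<Longrightarrow> (\<lambda>\<omega>. grad (x t \<omega>)) \<in> borel_measurable M"
  by (rule borel_measurable_continuous_on[OF continuous_grad measurable_x])

lemma bounded_grad: "1 \<le> t \<Longrightarrow> AE \<omega> in M. norm (grad (x t \<omega>)) \<le> L * R"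
  using bounded by (rule eventually_mono)
    (use L_pos in \<open>auto intro: order_trans[OF norm_grad_le] mult_left_mono\<close>)

lemma integrable_grad_square: "1 \<le> t \<Longrightarrow> integrable M (\<lambda>\<omega>. (norm (grad (x t \<omega>)))\<^sup>2)"
  using measurable_grad_x'
  by (intro integrable_const_bound[where B = "(L * R)\<^sup>2"] eventually_mono[OF bounded_grad])
    (auto intro: power_mono)

lemma integrable_gap:
  assumes "1 \<le> t" shows "integrable M (\<lambda>\<omega>. f (x t \<omega>) - f xs)"
proof (rule integrable_const_bound)
  show "AE \<omega> in M. norm (f (x t \<omega>) - f xs) \<le> L * R * R"
    using bounded[OF assms] bounded_grad[OF assms]
  proof eventually_elim
    case (elim \<omega>)
    have "f (x t \<omega>) - f xs \<le> norm (grad (x t \<omega>)) * norm (x t \<omega> - xs)"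
      using gap_le_inner norm_cauchy_schwarz order_trans by blast
    also have "\<dots> \<le> (L * R) * R"
      using elim order_trans[OF norm_ge_zero] by (intro mult_mono) auto
    finally show ?case using minimizer[of "x t \<omega>"] by simp
  qed
  show "(\<lambda>\<omega>. f (x t \<omega>) - f xs) \<in> borel_measurable M"
    using borel_measurable_continuous_on[OF continuous_f measurable_x[OF assms]] by simp
qed

text \<open>
  The inner product is a finite sum of products \<open>g t $ i * h $ i\<close>, and a past-measurable factor may
  be pulled out of the conditional expectation of each coordinate. Two choices of \<open>h\<close> matter:
  \<open>x t - xs\<close> for the regret and \<open>grad (x t)\<close> for the cross term of the variance.
\<close>

lemma expectation_inner_oracle:
  assumes t: "1 \<le> t" and square: "integrable M (\<lambda>\<omega>. (norm (g t \<omega>))\<^sup>2)"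
    and h: "h \<in> borel_measurable (\<F> t)" and h_bounded: "AE \<omega> in M. norm (h \<omega>) \<le> K"
  shows "integrable M (\<lambda>\<omega>. g t \<omega> \<bullet> h \<omega>)" "integrable M (\<lambda>\<omega>. grad (x t \<omega>) \<bullet> h \<omega>)"
    "expectation (\<lambda>\<omega>. g t \<omega> \<bullet> h \<omega>) = expectation (\<lambda>\<omega>. grad (x t \<omega>) \<bullet> h \<omega>)"
proof -
  note g_meas [measurable] = measurable_g[OF t]
  note grad_meas [measurable] = measurable_grad_x'[OF t]
  have hM [measurable]: "h \<in> borel_measurable M"
    by (rule measurable_from_subalg[OF subalgebra_\<F> h])
  have norm_g: "integrable M (\<lambda>\<omega>. norm (g t \<omega>))"
    by (rule square_integrable_imp_integrable[OF _ square]) measurable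
  have h_nth: "(\<lambda>\<omega>. h \<omega> $ i) \<in> borel_measurable (\<F> t)" for i
    by (rule measurable_compose[OF h borel_measurable_vec_nth])
  have g_nth: "(\<lambda>\<omega>. g t \<omega> $ i) \<in> borel_measurable M" for i
    by measurable
  have int: "integrable M (\<lambda>\<omega>. h \<omega> $ i * g t \<omega> $ i)" for i
  proof (rule Bochner_Integration.integrable_bound)
    show "integrable M (\<lambda>\<omega>. K * norm (g t \<omega>))" using norm_g by simp
    show "AE \<omega> in M. norm (h \<omega> $ i * g t \<omega> $ i) \<le> norm (K * norm (g t \<omega>))"
      using h_bounded
    proof eventually_elim
      case (elim \<omega>)
      have "\<bar>h \<omega> $ i\<bar> * \<bar>g t \<omega> $ i\<bar> \<le> K * norm (g t \<omega>)"
        using component_le_norm_cart[of "h \<omega>" i] component_le_norm_cart[of "g t \<omega>" i] elim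
        by (intro mult_mono) auto
      also have "\<dots> \<le> \<bar>K * norm (g t \<omega>)\<bar>" by (rule abs_ge_self)
      finally show ?case by (simp only: real_norm_def abs_mult)
    qed
  qed measurable
  note cond = past.real_cond_exp_intg[OF int h_nth g_nth]
  have AE_eq: "AE \<omega> in M. h \<omega> $ i * real_cond_exp M (\<F> t) (\<lambda>\<omega>. g t \<omega> $ i) \<omega>
      = h \<omega> $ i * grad (x t \<omega>) $ i" for i
  proof -
    have "AE \<omega> in M. real_cond_exp M (\<F> t) (\<lambda>\<omega>. g t \<omega> $ i) \<omega> = grad (x t \<omega>) $ i"
      using unbiased t unfolding unbiased_oracle_def by blast
    then show ?thesis by (rule eventually_mono) simp
  qed
  have int': "integrable M (\<lambda>\<omega>. h \<omega> $ i * grad (x t \<omega>) $ i)" for i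
    by (rule integrable_cong_AE_imp[OF cond(1) _ AE_eq]) measurable
  have "expectation (\<lambda>\<omega>. h \<omega> $ i * real_cond_exp M (\<F> t) (\<lambda>\<omega>. g t \<omega> $ i) \<omega>)
      = expectation (\<lambda>\<omega>. h \<omega> $ i * grad (x t \<omega>) $ i)" for i
    by (rule integral_cong_AE[OF _ _ AE_eq]) measurable
  then have eq: "expectation (\<lambda>\<omega>. h \<omega> $ i * g t \<omega> $ i)
      = expectation (\<lambda>\<omega>. h \<omega> $ i * grad (x t \<omega>) $ i)" for i
    using cond(2)[of i] by simp
  show "integrable M (\<lambda>\<omega>. g t \<omega> \<bullet> h \<omega>)" "integrable M (\<lambda>\<omega>. grad (x t \<omega>) \<bullet> h \<omega>)"
    using int int' by (auto simp: inner_vec_def mult.commute)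
  show "expectation (\<lambda>\<omega>. g t \<omega> \<bullet> h \<omega>) = expectation (\<lambda>\<omega>. grad (x t \<omega>) \<bullet> h \<omega>)"
    using int int' eq by (simp add: inner_vec_def mult.commute)
qed

lemma moment_of_second_moment_bound:
  assumes "second_moment_bound M f grad xs A B C x g" "0 \<le> A" "0 \<le> B" "0 \<le> C" and t: "1 \<le> t"
  shows "integrable M (\<lambda>\<omega>. (norm (g t \<omega>))\<^sup>2)"
    "expectation (\<lambda>\<omega>. (norm (g t \<omega>))\<^sup>2)
      \<le> A * expectation (\<lambda>\<omega>. f (x t \<omega>) - f xs) + B * expectation (\<lambda>\<omega>. (norm (grad (x t \<omega>)))\<^sup>2) + C"
proof -
  let ?k = "\<lambda>\<omega>. A * (f (x t \<omega>) - f xs) + B * (norm (grad (x t \<omega>)))\<^sup>2 + C"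
  note ints = integrable_gap[OF t] integrable_grad_square[OF t]
  note [measurable] = measurable_g[OF t]
  have k: "integrable M ?k" by (intro Bochner_Integration.integrable_add integrable_mult_right ints) simp
  have nonneg: "0 \<le> ?k \<omega>" for \<omega>
    using assms minimizer[of "x t \<omega>"] by simp
  have le: "AE \<omega> in M. nn_cond_exp M (\<F> t) (\<lambda>\<omega>. ennreal ((norm (g t \<omega>))\<^sup>2)) \<omega> \<le> ennreal (?k \<omega>)"
    using assms by (simp add: second_moment_bound_def)
  have meas: "(\<lambda>\<omega>. (norm (g t \<omega>))\<^sup>2) \<in> borel_measurable M" by measurable
  note * = past.integral_le_of_nn_cond_exp_le[OF meas _ k nonneg le]
  show "integrable M (\<lambda>\<omega>. (norm (g t \<omega>))\<^sup>2)" by (rule *) simp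
  have "expectation ?k = A * expectation (\<lambda>\<omega>. f (x t \<omega>) - f xs)
      + B * expectation (\<lambda>\<omega>. (norm (grad (x t \<omega>)))\<^sup>2) + C"
    using ints by (simp add: prob_space del: Bochner_Integration.integral_diff)
  with *(2) show "expectation (\<lambda>\<omega>. (norm (g t \<omega>))\<^sup>2)
      \<le> A * expectation (\<lambda>\<omega>. f (x t \<omega>) - f xs) + B * expectation (\<lambda>\<omega>. (norm (grad (x t \<omega>)))\<^sup>2) + C"
    by simp
qed

text \<open>
  Expanding the square of the noise, unbiasedness turns the cross term into twice the expected squared
  gradient norm.
\<close>

lemma moment_of_bounded_variance:
  assumes "bounded_variance M grad \<sigma> x g" and t: "1 \<le> t"
  shows "integrable M (\<lambda>\<omega>. (norm (g t \<omega>))\<^sup>2)"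
    "expectation (\<lambda>\<omega>. (norm (g t \<omega>))\<^sup>2) \<le> expectation (\<lambda>\<omega>. (norm (grad (x t \<omega>)))\<^sup>2) + \<sigma>\<^sup>2"
proof -
  let ?n = "\<lambda>\<omega>. g t \<omega> - grad (x t \<omega>)"
  note [measurable] = measurable_g[OF t] measurable_grad_x'[OF t]
  have meas: "(\<lambda>\<omega>. (norm (?n \<omega>))\<^sup>2) \<in> borel_measurable M" by measurable
  have le: "AE \<omega> in M. nn_cond_exp M (\<F> t) (\<lambda>\<omega>. ennreal ((norm (?n \<omega>))\<^sup>2)) \<omega> \<le> ennreal (\<sigma>\<^sup>2)"
    using assms by (simp add: bounded_variance_def)
  note noise = past.integral_le_of_nn_cond_exp_le[OF meas _ _ _ le]
  have noise_int: "integrable M (\<lambda>\<omega>. (norm (?n \<omega>))\<^sup>2)" by (rule noise) auto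
  have noise_le: "expectation (\<lambda>\<omega>. (norm (?n \<omega>))\<^sup>2) \<le> \<sigma>\<^sup>2"
    using noise(2) by (simp add: prob_space)
  show int: "integrable M (\<lambda>\<omega>. (norm (g t \<omega>))\<^sup>2)"
  proof (rule Bochner_Integration.integrable_bound)
    show "integrable M (\<lambda>\<omega>. 2 * (norm (?n \<omega>))\<^sup>2 + 2 * (norm (grad (x t \<omega>)))\<^sup>2)"
      using noise_int integrable_grad_square[OF t] by simp
    have "(norm (g t \<omega>))\<^sup>2 \<le> 2 * (norm (?n \<omega>))\<^sup>2 + 2 * (norm (grad (x t \<omega>)))\<^sup>2" for \<omega>
      by (rule norm_square_le_twice)
    then show "AE \<omega> in M. norm ((norm (g t \<omega>))\<^sup>2)
        \<le> norm (2 * (norm (?n \<omega>))\<^sup>2 + 2 * (norm (grad (x t \<omega>)))\<^sup>2)"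
      by (intro AE_I2) simp
  qed measurable
  note cross = expectation_inner_oracle[OF t int measurable_grad_x[OF t] bounded_grad[OF t]]
  have "expectation (\<lambda>\<omega>. (norm (?n \<omega>))\<^sup>2) = expectation (\<lambda>\<omega>. (norm (g t \<omega>))\<^sup>2
      - 2 * (g t \<omega> \<bullet> grad (x t \<omega>)) + (norm (grad (x t \<omega>)))\<^sup>2)"
    unfolding power2_norm_eq_inner
    by (rule Bochner_Integration.integral_cong)
      (simp_all add: inner_diff_left inner_diff_right inner_commute algebra_simps)
  also have "\<dots> = expectation (\<lambda>\<omega>. (norm (g t \<omega>))\<^sup>2)
      - 2 * expectation (\<lambda>\<omega>. g t \<omega> \<bullet> grad (x t \<omega>)) + expectation (\<lambda>\<omega>. (norm (grad (x t \<omega>)))\<^sup>2)"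
    using int cross(1) integrable_grad_square[OF t] by simp
  also have "expectation (\<lambda>\<omega>. g t \<omega> \<bullet> grad (x t \<omega>)) = expectation (\<lambda>\<omega>. (norm (grad (x t \<omega>)))\<^sup>2)"
    unfolding power2_norm_eq_inner by (rule cross(3))
  finally show "expectation (\<lambda>\<omega>. (norm (g t \<omega>))\<^sup>2) \<le> expectation (\<lambda>\<omega>. (norm (grad (x t \<omega>)))\<^sup>2) + \<sigma>\<^sup>2"
    using noise_le by simp
qed

lemma avg_iterate_gap_le:
  assumes "1 \<le> T"
  shows "f (avg_iterate x T \<omega>) - f xs \<le> (\<Sum>t=1..T. f (x t \<omega>) - f xs) / T"
proof -
  have "f (\<Sum>t\<in>{1..T}. (1 / T) *\<^sub>R x t \<omega>) \<le> (\<Sum>t\<in>{1..T}. 1 / T * f (x t \<omega>))"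
    using assms by (intro convex_on_sum[OF _ _ convex]) auto
  moreover have "avg_iterate x T \<omega> = (\<Sum>t\<in>{1..T}. (1 / T) *\<^sub>R x t \<omega>)"
    by (simp add: avg_iterate_def scaleR_sum_right)
  ultimately show ?thesis
    using assms by (simp add: sum_subtractf diff_divide_distrib flip: sum_divide_distrib)
qed

lemma expected_gap_le_of_gap_sum:
  assumes "1 \<le> T" and S: "(\<Sum>t=1..T. expectation (\<lambda>\<omega>. f (x t \<omega>) - f xs)) / T \<le> r"
  shows "expected_gap_le M f xs x T r"
proof -
  let ?avg = "\<lambda>\<omega>. f (avg_iterate x T \<omega>) - f xs"
  let ?mean = "\<lambda>\<omega>. (\<Sum>t=1..T. f (x t \<omega>) - f xs) / T"
  have mean: "integrable M ?mean"
    by (intro Bochner_Integration.integrable_divide Bochner_Integration.integrable_sum integrable_gap) auto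
  have "(\<lambda>\<omega>. avg_iterate x T \<omega>) \<in> borel_measurable M"
    unfolding avg_iterate_def
    by (intro borel_measurable_scaleR borel_measurable_const borel_measurable_sum measurable_x) auto
  then have meas: "?avg \<in> borel_measurable M"
    by (intro borel_measurable_diff borel_measurable_const borel_measurable_continuous_on[OF continuous_f])
  have avg: "integrable M ?avg"
  proof (rule Bochner_Integration.integrable_bound[OF mean meas], rule AE_I2)
    show "norm (?avg \<omega>) \<le> norm (?mean \<omega>)" for \<omega>
      using avg_iterate_gap_le[OF \<open>1 \<le> T\<close>, of \<omega>] minimizer[of "avg_iterate x T \<omega>"]
        abs_ge_self[of "?mean \<omega>"] unfolding real_norm_def by linarith
  qed
  have "expectation ?avg \<le> expectation ?mean"
    by (rule integral_mono[OF avg mean]) (rule avg_iterate_gap_le[OF \<open>1 \<le> T\<close>])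
  also have "\<dots> = (\<Sum>t=1..T. expectation (\<lambda>\<omega>. f (x t \<omega>) - f xs)) / T"
    using integrable_gap by (simp del: Bochner_Integration.integral_diff)
  finally show ?thesis using avg S by (simp add: expected_gap_le_def)
qed

text \<open>
  The heart of the argument, for any method with the pathwise regret bound: \<open>S\<close> is bounded by a
  square root that itself contains \<open>S\<close>, because the second moments are controlled by the gaps.
\<close>

lemma expected_gap_le_of_regret:
  assumes square: "\<And>t. 1 \<le> t \<Longrightarrow> integrable M (\<lambda>\<omega>. (norm (g t \<omega>))\<^sup>2)"
    and moment: "\<And>t. 1 \<le> t \<Longrightarrow> expectation (\<lambda>\<omega>. (norm (g t \<omega>))\<^sup>2)
      \<le> A * expectation (\<lambda>\<omega>. f (x t \<omega>) - f xs) + B * expectation (\<lambda>\<omega>. (norm (grad (x t \<omega>)))\<^sup>2) + C"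
    and regret: "AE \<omega> in M. (\<Sum>t=1..T. g t \<omega> \<bullet> (x t \<omega> - xs))
      \<le> \<Gamma> * sqrt (\<beta>\<^sup>2 + (\<Sum>t=1..T. (norm (g t \<omega>))\<^sup>2))"
    and nonneg: "0 \<le> A" "0 \<le> B" "0 \<le> C" "0 \<le> \<Gamma>" "0 \<le> \<beta>" and T: "1 \<le> T"
  shows "expected_gap_le M f xs x T
    ((\<Gamma>\<^sup>2 * (A + 2 * L * B) + \<Gamma> * \<beta>) / real T + \<Gamma> * sqrt (C / real T))"
proof (rule expected_gap_le_of_gap_sum[OF T])
  define S where "S = (\<Sum>t=1..T. expectation (\<lambda>\<omega>. f (x t \<omega>) - f xs))"
  let ?Q = "A + 2 * L * B"
  let ?Y = "\<lambda>\<omega>. \<beta>\<^sup>2 + (\<Sum>t=1..T. (norm (g t \<omega>))\<^sup>2)"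
  have centered: "(\<lambda>\<omega>. x t \<omega> - xs) \<in> borel_measurable (\<F> t)" if "1 \<le> t" for t
    using adapted[OF that] by simp
  note inner = expectation_inner_oracle[OF _ square centered bounded]
  have gap_nonneg: "0 \<le> f (x t \<omega>) - f xs" for t \<omega>
    using minimizer[of "x t \<omega>"] by simp
  have "0 \<le> S"
    unfolding S_def by (intro sum_nonneg Bochner_Integration.integral_nonneg gap_nonneg)
  have Y: "integrable M ?Y"
    by (intro Bochner_Integration.integrable_add Bochner_Integration.integrable_sum square) auto
  have Y_nonneg: "0 \<le> ?Y \<omega>" for \<omega>
    by (intro add_nonneg_nonneg sum_nonneg) auto
  have second: "expectation (\<lambda>\<omega>. (norm (g t \<omega>))\<^sup>2)
      \<le> ?Q * expectation (\<lambda>\<omega>. f (x t \<omega>) - f xs) + C" if t: "1 \<le> t" for t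
  proof -
    have "expectation (\<lambda>\<omega>. (norm (grad (x t \<omega>)))\<^sup>2)
        \<le> expectation (\<lambda>\<omega>. 2 * L * (f (x t \<omega>) - f xs))"
      by (intro integral_mono integrable_mult_right integrable_grad_square integrable_gap
          norm_grad_square_le_gap t)
    also have "\<dots> = 2 * L * expectation (\<lambda>\<omega>. f (x t \<omega>) - f xs)"
      by (rule integral_mult_right_zero)
    finally have "B * expectation (\<lambda>\<omega>. (norm (grad (x t \<omega>)))\<^sup>2)
        \<le> B * (2 * L * expectation (\<lambda>\<omega>. f (x t \<omega>) - f xs))"
      using \<open>0 \<le> B\<close> by (rule mult_left_mono)
    with moment[OF t] show ?thesis by (simp add: algebra_simps del: Bochner_Integration.integral_diff)
  qed
  have "S \<le> (\<Sum>t=1..T. expectation (\<lambda>\<omega>. grad (x t \<omega>) \<bullet> (x t \<omega> - xs)))"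
    unfolding S_def by (intro sum_mono integral_mono integrable_gap inner(2) gap_le_inner) auto
  also have "\<dots> = (\<Sum>t=1..T. expectation (\<lambda>\<omega>. g t \<omega> \<bullet> (x t \<omega> - xs)))"
    by (intro sum.cong inner(3)[symmetric]) auto
  also have "\<dots> = expectation (\<lambda>\<omega>. \<Sum>t=1..T. g t \<omega> \<bullet> (x t \<omega> - xs))"
    by (rule Bochner_Integration.integral_sum[symmetric]) (use inner(1) in auto)
  also have "\<dots> \<le> expectation (\<lambda>\<omega>. \<Gamma> * sqrt (?Y \<omega>))"
  proof (rule integral_mono_AE[OF _ _ regret])
    show "integrable M (\<lambda>\<omega>. \<Sum>t=1..T. g t \<omega> \<bullet> (x t \<omega> - xs))"
      by (rule Bochner_Integration.integrable_sum) (use inner(1) in auto)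
    show "integrable M (\<lambda>\<omega>. \<Gamma> * sqrt (?Y \<omega>))"
      by (intro integrable_mult_right expectation_sqrt_le(1)[OF Y Y_nonneg])
  qed
  also have "\<dots> = \<Gamma> * expectation (\<lambda>\<omega>. sqrt (?Y \<omega>))"
    by (rule integral_mult_right_zero)
  also have "\<dots> \<le> \<Gamma> * sqrt (expectation ?Y)"
    using expectation_sqrt_le(2)[OF Y Y_nonneg] \<open>0 \<le> \<Gamma>\<close> by (rule mult_left_mono)
  also have "expectation ?Y = \<beta>\<^sup>2 + (\<Sum>t=1..T. expectation (\<lambda>\<omega>. (norm (g t \<omega>))\<^sup>2))"
    using square by (subst Bochner_Integration.integral_add)
      (auto simp: prob_space intro!: Bochner_Integration.integral_sum)
  also have "\<Gamma> * sqrt \<dots> \<le> \<Gamma> * sqrt (\<beta>\<^sup>2 + (?Q * S + C * T))"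
  proof -
    have "(\<Sum>t=1..T. expectation (\<lambda>\<omega>. (norm (g t \<omega>))\<^sup>2))
        \<le> (\<Sum>t=1..T. ?Q * expectation (\<lambda>\<omega>. f (x t \<omega>) - f xs) + C)"
      by (intro sum_mono second) auto
    also have "\<dots> = ?Q * S + C * T"
      unfolding S_def by (simp only: sum.distrib sum_distrib_left[symmetric] sum_constant) simp
    finally show ?thesis using \<open>0 \<le> \<Gamma>\<close> by (intro mult_left_mono) auto
  qed
  finally have "S \<le> \<Gamma>\<^sup>2 * ?Q + \<Gamma> * \<beta> + \<Gamma> * sqrt (C * T)"
    by (rule quadratic_inequality_bound) (use \<open>0 \<le> S\<close> nonneg L_pos in auto)
  then have "S / T \<le> (\<Gamma>\<^sup>2 * ?Q + \<Gamma> * \<beta>) / T + \<Gamma> * (sqrt (C * T) / T)"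
    using T by (simp add: field_simps)
  also have "sqrt (C * T) / T = sqrt (C / T)"
    using T by (simp add: real_sqrt_mult real_sqrt_divide real_div_sqrt field_simps)
  finally show "S / T \<le> (\<Gamma>\<^sup>2 * ?Q + \<Gamma> * \<beta>) / T + \<Gamma> * sqrt (C / T)" .
qed

end

section \<open>Convergence rates of the two algorithms\<close>

lemma bounded_adagrad_norm_process_regret:
  assumes problem: "smooth_convex_minimization f grad xs L"
    and process: "bounded_adagrad_norm_process M grad xs b0 \<eta> D x g"
    and "0 < \<eta>" "0 < b0"
  shows "bounded_oracle_process f grad xs L M x g D"
    "AE \<omega> in M. (\<Sum>t=1..T. g t \<omega> \<bullet> (x t \<omega> - xs))
      \<le> (D\<^sup>2 / (2 * \<eta>) + \<eta>) * sqrt (b0\<^sup>2 + (\<Sum>t=1..T. (norm (g t \<omega>))\<^sup>2))"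
proof -
  have unbiased: "unbiased_oracle M grad x g" and prob: "prob_space M"
    and run: "\<And>\<omega>. \<omega> \<in> space M \<Longrightarrow> adagrad_norm b0 \<eta> (\<lambda>t. x t \<omega>) (\<lambda>t. g t \<omega>)"
    and bounded: "\<And>t. 1 \<le> t \<Longrightarrow> AE \<omega> in M. norm (x t \<omega> - xs) \<le> D"
    using process by (auto simp: bounded_adagrad_norm_process_def)
  obtain x1 where init: "\<And>\<omega>. \<omega> \<in> space M \<Longrightarrow> x 1 \<omega> = x1"
    using unbiased unfolding unbiased_oracle_def by blast
  have adapted: "x t \<in> borel_measurable (oracle_filtration M g (t - 1))" if "1 \<le> t" for t
  proof (rule adapted_iterates[where u = "\<lambda>t \<omega>. (\<eta> / adagrad_norm_b b0 (\<lambda>t. g t \<omega>) t) *\<^sub>R g t \<omega>"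
        and start = x1])
    show "x (Suc t) \<omega> = x t \<omega> - (\<eta> / adagrad_norm_b b0 (\<lambda>t. g t \<omega>) t) *\<^sub>R g t \<omega>"
      if "1 \<le> t" "\<omega> \<in> space M" for t \<omega>
      using run[OF that(2)] that(1) by (simp add: adagrad_norm_def)
  qed (use init that in \<open>(blast intro: measurable_adagrad_norm_step)+\<close>)
  from problem prob unbiased adapted bounded show "bounded_oracle_process f grad xs L M x g D"
    by (simp add: bounded_oracle_process_def bounded_oracle_process_axioms_def)
  have "AE \<omega> in M. \<forall>t\<in>{1..}. norm (x t \<omega> - xs) \<le> D"
    using bounded by (intro AE_ball_countable') auto
  then show "AE \<omega> in M. (\<Sum>t=1..T. g t \<omega> \<bullet> (x t \<omega> - xs))
      \<le> (D\<^sup>2 / (2 * \<eta>) + \<eta>) * sqrt (b0\<^sup>2 + (\<Sum>t=1..T. (norm (g t \<omega>))\<^sup>2))"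
    using AE_space
  proof eventually_elim
    case (elim \<omega>)
    show ?case
      by (rule adagrad_norm_regret[OF run[OF elim(2)] \<open>0 < b0\<close> \<open>0 < \<eta>\<close>]) (use elim(1) in auto)
  qed
qed

lemma bounded_adagrad_process_regret:
  fixes D :: "real ^ 'd"
  assumes problem: "smooth_convex_minimization f grad xs L"
    and process: "bounded_adagrad_process M grad xs b0 \<eta> D x g"
    and "0 < \<eta>" "\<And>i. 0 < b0 $ i"
  shows "bounded_oracle_process f grad xs L M x g (\<Sum>i\<in>UNIV. D $ i)"
    "AE \<omega> in M. (\<Sum>t=1..T. g t \<omega> \<bullet> (x t \<omega> - xs))
      \<le> sqrt (\<Sum>i\<in>UNIV. ((D $ i)\<^sup>2 / (2 * \<eta>) + \<eta>)\<^sup>2)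
        * sqrt ((sqrt (\<Sum>i\<in>UNIV. (b0 $ i)\<^sup>2))\<^sup>2 + (\<Sum>t=1..T. (norm (g t \<omega>))\<^sup>2))"
proof -
  have unbiased: "unbiased_oracle M grad x g" and prob: "prob_space M"
    and run: "\<And>\<omega>. \<omega> \<in> space M \<Longrightarrow> adagrad b0 \<eta> (\<lambda>t. x t \<omega>) (\<lambda>t. g t \<omega>)"
    and bounded: "\<And>t i. 1 \<le> t \<Longrightarrow> AE \<omega> in M. \<bar>x t \<omega> $ i - xs $ i\<bar> \<le> D $ i"
    using process by (auto simp: bounded_adagrad_process_def)
  obtain x1 where init: "\<And>\<omega>. \<omega> \<in> space M \<Longrightarrow> x 1 \<omega> = x1"
    using unbiased unfolding unbiased_oracle_def by blast
  have adapted: "x t \<in> borel_measurable (oracle_filtration M g (t - 1))" if "1 \<le> t" for t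
  proof (rule adapted_iterates[where u = "\<lambda>t \<omega>. \<chi> i. \<eta> * g t \<omega> $ i / adagrad_b b0 (\<lambda>t. g t \<omega>) t i"
        and start = x1])
    show "x (Suc t) \<omega> = x t \<omega> - (\<chi> i. \<eta> * g t \<omega> $ i / adagrad_b b0 (\<lambda>t. g t \<omega>) t i)"
      if "1 \<le> t" "\<omega> \<in> space M" for t \<omega>
      using run[OF that(2)] that(1) by (simp add: adagrad_def vec_eq_iff)
  qed (use init that in \<open>(blast intro: measurable_adagrad_step)+\<close>)
  have all: "AE \<omega> in M. \<forall>i\<in>UNIV. \<bar>x t \<omega> $ i - xs $ i\<bar> \<le> D $ i" if "1 \<le> t" for t
    using bounded[OF that] by (intro AE_finite_allI) auto
  \<comment> \<open>The l1 norm dominates the Euclidean norm; any deterministic radius will do here.\<close>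
  have "AE \<omega> in M. norm (x t \<omega> - xs) \<le> (\<Sum>i\<in>UNIV. D $ i)" if "1 \<le> t" for t
    using all[OF that]
  proof eventually_elim
    case (elim \<omega>)
    have "norm (x t \<omega> - xs) \<le> (\<Sum>i\<in>UNIV. \<bar>(x t \<omega> - xs) $ i\<bar>)"
      by (rule norm_le_l1_cart)
    also have "\<dots> \<le> (\<Sum>i\<in>UNIV. D $ i)"
      using elim by (intro sum_mono) simp
    finally show ?case .
  qed
  with problem prob unbiased adapted
  show "bounded_oracle_process f grad xs L M x g (\<Sum>i\<in>UNIV. D $ i)"
    by (simp add: bounded_oracle_process_def bounded_oracle_process_axioms_def)
  have "AE \<omega> in M. \<forall>t\<in>{1..}. \<forall>i\<in>UNIV. \<bar>x t \<omega> $ i - xs $ i\<bar> \<le> D $ i"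
    by (rule AE_ball_countable') (use all in auto)
  then show "AE \<omega> in M. (\<Sum>t=1..T. g t \<omega> \<bullet> (x t \<omega> - xs))
      \<le> sqrt (\<Sum>i\<in>UNIV. ((D $ i)\<^sup>2 / (2 * \<eta>) + \<eta>)\<^sup>2)
        * sqrt ((sqrt (\<Sum>i\<in>UNIV. (b0 $ i)\<^sup>2))\<^sup>2 + (\<Sum>t=1..T. (norm (g t \<omega>))\<^sup>2))"
    using AE_space
  proof eventually_elim
    case (elim \<omega>)
    show ?case
      by (rule adagrad_coordinatewise_regret[OF run[OF elim(2)] assms(4) \<open>0 < \<eta>\<close>]) (use elim(1) in auto)
  qed
qed

lemma expected_gap_le_mono:
  "expected_gap_le M f xs x T r \<Longrightarrow> r \<le> r' \<Longrightarrow> expected_gap_le M f xs x T r'"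
  by (auto simp: expected_gap_le_def)

text \<open>
  The two-term bound fits under one constant that does not involve \<open>\<sigma>\<close>, as uniformity in \<open>\<sigma>\<close>
  requires.
\<close>

lemma variance_rate_le:
  fixes \<Gamma> \<sigma> a T :: real
  assumes "0 \<le> \<Gamma>" "0 \<le> a" "0 \<le> \<sigma>" "0 < T"
  shows "a / T + \<Gamma> * sqrt (\<sigma>\<^sup>2 / T) \<le> (a + \<Gamma>) * (1 / T + \<sigma> / sqrt T)"
proof -
  have "0 \<le> a * (\<sigma> / sqrt T)" "0 \<le> \<Gamma> * (1 / T)"
    using assms by auto
  moreover have "sqrt (\<sigma>\<^sup>2 / T) = \<sigma> / sqrt T"
    using assms by (simp add: real_sqrt_divide)
  ultimately show ?thesis by (simp add: algebra_simps add_divide_distrib)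
qed

theorem theorem3p14:
  fixes f :: "real ^ 'd \<Rightarrow> real" and grad :: "real ^ 'd \<Rightarrow> real ^ 'd" and xs :: "real ^ 'd"
    and L A B C \<eta> b0 D :: real and b0v Dv :: "real ^ 'd"
  assumes gradient: "\<And>x. GDERIV f x :> grad x"
    and convex: "convex_on UNIV f"
    and minimizer: "\<And>y. f xs \<le> f y"
    and "L > 0"
    and smooth: "\<And>x y. norm (grad x - grad y) \<le> L * norm (x - y)"
    and "A \<ge> 0" "B \<ge> 0" "C \<ge> 0"
    and "\<eta> > 0" "b0 > 0" "\<And>i. b0v $ i > 0"
    and "D \<ge> 0" "\<And>i. Dv $ i \<ge> 0"
  shows
    "let Q = A + 2 * L * B;
         \<Gamma> = D\<^sup>2 / (2 * \<eta>) + \<eta>;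
         \<Lambda> = sqrt (\<Sum>i\<in>UNIV. ((Dv $ i)\<^sup>2 / (2 * \<eta>) + \<eta>)\<^sup>2);
         \<beta>0 = sqrt (\<Sum>i\<in>UNIV. (b0v $ i)\<^sup>2)
     in
       \<comment> \<open>explicit bounds under the second-moment condition\<close>
       (\<forall>(M :: 'w measure) x g.
          bounded_adagrad_norm_process M grad xs b0 \<eta> D x g \<longrightarrow>
          second_moment_bound M f grad xs A B C x g \<longrightarrow>
          (\<forall>T\<ge>1. expected_gap_le M f xs x T
             ((\<Gamma>\<^sup>2 * Q + \<Gamma> * b0) / real T + \<Gamma> * sqrt (C / real T)))) \<and>
       (\<forall>(M :: 'w measure) x g.
          bounded_adagrad_process M grad xs b0v \<eta> Dv x g \<longrightarrow>
          second_moment_bound M f grad xs A B C x g \<longrightarrow>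
          (\<forall>T\<ge>1. expected_gap_le M f xs x T
             ((\<Lambda>\<^sup>2 * Q + \<Lambda> * \<beta>0) / real T + \<Lambda> * sqrt (C / real T)))) \<and>
       \<comment> \<open>rate 1/T when C = 0; the constant is uniform in T, in the probability space and in the oracle\<close>
       (\<exists>K. \<forall>(M :: 'w measure) x g.
          bounded_adagrad_norm_process M grad xs b0 \<eta> D x g \<longrightarrow>
          second_moment_bound M f grad xs A B 0 x g \<longrightarrow>
          (\<forall>T\<ge>1. expected_gap_le M f xs x T (K * (1 / real T)))) \<and>
       (\<exists>K. \<forall>(M :: 'w measure) x g.
          bounded_adagrad_process M grad xs b0v \<eta> Dv x g \<longrightarrow>
          second_moment_bound M f grad xs A B 0 x g \<longrightarrow>
          (\<forall>T\<ge>1. expected_gap_le M f xs x T (K * (1 / real T)))) \<and>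
       \<comment> \<open>explicit bounds under bounded variance\<close>
       (\<forall>\<sigma>\<ge>0. \<forall>(M :: 'w measure) x g.
          bounded_adagrad_norm_process M grad xs b0 \<eta> D x g \<longrightarrow>
          bounded_variance M grad \<sigma> x g \<longrightarrow>
          (\<forall>T\<ge>1. expected_gap_le M f xs x T
             ((\<Gamma>\<^sup>2 * (2 * L) + \<Gamma> * b0) / real T + \<Gamma> * sqrt (\<sigma>\<^sup>2 / real T)))) \<and>
       (\<forall>\<sigma>\<ge>0. \<forall>(M :: 'w measure) x g.
          bounded_adagrad_process M grad xs b0v \<eta> Dv x g \<longrightarrow>
          bounded_variance M grad \<sigma> x g \<longrightarrow>
          (\<forall>T\<ge>1. expected_gap_le M f xs x T
             ((\<Lambda>\<^sup>2 * (2 * L) + \<Lambda> * \<beta>0) / real T + \<Lambda> * sqrt (\<sigma>\<^sup>2 / real T)))) \<and>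
       \<comment> \<open>rate 1/T + \<open>\<sigma>\<close>/sqrt T under bounded variance; the constant is also uniform in \<open>\<sigma>\<close>\<close>
       (\<exists>K. \<forall>\<sigma>\<ge>0. \<forall>(M :: 'w measure) x g.
          bounded_adagrad_norm_process M grad xs b0 \<eta> D x g \<longrightarrow>
          bounded_variance M grad \<sigma> x g \<longrightarrow>
          (\<forall>T\<ge>1. expected_gap_le M f xs x T (K * (1 / real T + \<sigma> / sqrt (real T))))) \<and>
       (\<exists>K. \<forall>\<sigma>\<ge>0. \<forall>(M :: 'w measure) x g.
          bounded_adagrad_process M grad xs b0v \<eta> Dv x g \<longrightarrow>
          bounded_variance M grad \<sigma> x g \<longrightarrow>
          (\<forall>T\<ge>1. expected_gap_le M f xs x T (K * (1 / real T + \<sigma> / sqrt (real T)))))"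
proof -
  define \<Gamma> where "\<Gamma> = D\<^sup>2 / (2 * \<eta>) + \<eta>"
  define \<Lambda> where "\<Lambda> = sqrt (\<Sum>i\<in>UNIV. ((Dv $ i)\<^sup>2 / (2 * \<eta>) + \<eta>)\<^sup>2)"
  define \<beta>0 where "\<beta>0 = sqrt (\<Sum>i\<in>UNIV. (b0v $ i)\<^sup>2)"
  have nonneg: "0 \<le> \<Gamma>" "0 \<le> \<Lambda>" "0 \<le> \<beta>0" "0 \<le> b0"
    using assms by (auto simp: \<Gamma>_def \<Lambda>_def \<beta>0_def sum_nonneg)
  have problem: "smooth_convex_minimization f grad xs L"
    by unfold_locales (use gradient convex minimizer smooth \<open>L > 0\<close> in auto)
  note norm_run = bounded_adagrad_norm_process_regret[where D = D, OF problem _ \<open>\<eta> > 0\<close> \<open>b0 > 0\<close>, folded \<Gamma>_def]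
  note coord_run = bounded_adagrad_process_regret[where D = Dv, OF problem _ \<open>\<eta> > 0\<close> \<open>\<And>i. b0v $ i > 0\<close>,
      folded \<Lambda>_def \<beta>0_def]
  \<comment> \<open>\<open>G\<close> and \<open>\<beta>\<close> stand for the regret constants of either algorithm, and \<open>C'\<close> for \<open>C\<close> or 0.\<close>
  have moment_bound: "expected_gap_le M f xs x T
      ((G\<^sup>2 * (A + 2 * L * B) + G * \<beta>) / real T + G * sqrt (C' / real T))"
    if "bounded_oracle_process f grad xs L M x g R" "second_moment_bound M f grad xs A B C' x g"
      "AE \<omega> in M. (\<Sum>t=1..T. g t \<omega> \<bullet> (x t \<omega> - xs)) \<le> G * sqrt (\<beta>\<^sup>2 + (\<Sum>t=1..T. (norm (g t \<omega>))\<^sup>2))"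
      "0 \<le> C'" "0 \<le> G" "0 \<le> \<beta>" "1 \<le> T"
    for M :: "'w measure" and x g R G \<beta> C' T
  proof -
    interpret bounded_oracle_process f grad xs L M x g R by (rule that)
    note moment = moment_of_second_moment_bound[OF that(2) \<open>A \<ge> 0\<close> \<open>B \<ge> 0\<close> \<open>0 \<le> C'\<close>]
    show ?thesis
      by (rule expected_gap_le_of_regret[OF moment that(3) \<open>A \<ge> 0\<close> \<open>B \<ge> 0\<close>]) (use that in auto)
  qed
  have variance_bound: "expected_gap_le M f xs x T
      ((G\<^sup>2 * (2 * L) + G * \<beta>) / real T + G * sqrt (\<sigma>\<^sup>2 / real T))"
    if "bounded_oracle_process f grad xs L M x g R" "bounded_variance M grad \<sigma> x g"
      "AE \<omega> in M. (\<Sum>t=1..T. g t \<omega> \<bullet> (x t \<omega> - xs)) \<le> G * sqrt (\<beta>\<^sup>2 + (\<Sum>t=1..T. (norm (g t \<omega>))\<^sup>2))"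
      "0 \<le> G" "0 \<le> \<beta>" "1 \<le> T"
    for M :: "'w measure" and x g R G \<beta> \<sigma> T
  proof -
    interpret bounded_oracle_process f grad xs L M x g R by (rule that)
    note moment = moment_of_bounded_variance[OF that(2)]
    have "expected_gap_le M f xs x T ((G\<^sup>2 * (0 + 2 * L * 1) + G * \<beta>) / real T + G * sqrt (\<sigma>\<^sup>2 / real T))"
      by (rule expected_gap_le_of_regret[OF moment(1) _ that(3)]) (use moment(2) that in auto)
    then show ?thesis by simp
  qed
  have rate: "expected_gap_le M f xs x T ((G\<^sup>2 * (2 * L) + G * \<beta> + G) * (1 / real T + \<sigma> / sqrt (real T)))"
    if "expected_gap_le M f xs x T ((G\<^sup>2 * (2 * L) + G * \<beta>) / real T + G * sqrt (\<sigma>\<^sup>2 / real T))"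
      "0 \<le> \<sigma>" "0 \<le> G" "0 \<le> \<beta>" "1 \<le> T"
    for M :: "'w measure" and x G \<beta> \<sigma> T
    by (rule expected_gap_le_mono[OF that(1)], rule variance_rate_le) (use that \<open>L > 0\<close> in auto)
  show ?thesis
    unfolding Let_def \<Gamma>_def[symmetric] \<Lambda>_def[symmetric] \<beta>0_def[symmetric]
  proof (intro conjI allI impI)
    show "expected_gap_le M f xs x T ((\<Gamma>\<^sup>2 * (A + 2 * L * B) + \<Gamma> * b0) / real T + \<Gamma> * sqrt (C / real T))"
      if "bounded_adagrad_norm_process M grad xs b0 \<eta> D x g" "second_moment_bound M f grad xs A B C x g"
        "1 \<le> T" for M :: "'w measure" and x g T
      by (rule moment_bound[OF norm_run(1) _ norm_run(2)]) (use that nonneg \<open>C \<ge> 0\<close> in auto)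
    show "expected_gap_le M f xs x T ((\<Lambda>\<^sup>2 * (A + 2 * L * B) + \<Lambda> * \<beta>0) / real T + \<Lambda> * sqrt (C / real T))"
      if "bounded_adagrad_process M grad xs b0v \<eta> Dv x g" "second_moment_bound M f grad xs A B C x g"
        "1 \<le> T" for M :: "'w measure" and x g T
      by (rule moment_bound[OF coord_run(1) _ coord_run(2)]) (use that nonneg \<open>C \<ge> 0\<close> in auto)
    show norm_variance:
      "expected_gap_le M f xs x T ((\<Gamma>\<^sup>2 * (2 * L) + \<Gamma> * b0) / real T + \<Gamma> * sqrt (\<sigma>\<^sup>2 / real T))"
      if "0 \<le> \<sigma>" "bounded_adagrad_norm_process M grad xs b0 \<eta> D x g" "bounded_variance M grad \<sigma> x g"
        "1 \<le> T" for \<sigma> and M :: "'w measure" and x g T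
      by (rule variance_bound[OF norm_run(1) _ norm_run(2)]) (use that nonneg in auto)
    show coord_variance:
      "expected_gap_le M f xs x T ((\<Lambda>\<^sup>2 * (2 * L) + \<Lambda> * \<beta>0) / real T + \<Lambda> * sqrt (\<sigma>\<^sup>2 / real T))"
      if "0 \<le> \<sigma>" "bounded_adagrad_process M grad xs b0v \<eta> Dv x g" "bounded_variance M grad \<sigma> x g"
        "1 \<le> T" for \<sigma> and M :: "'w measure" and x g T
      by (rule variance_bound[OF coord_run(1) _ coord_run(2)]) (use that nonneg in auto)
    show "\<exists>K. \<forall>(M :: 'w measure) x g. bounded_adagrad_norm_process M grad xs b0 \<eta> D x g \<longrightarrow>
        second_moment_bound M f grad xs A B 0 x g \<longrightarrow>
        (\<forall>T\<ge>1. expected_gap_le M f xs x T (K * (1 / real T)))"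
    proof (intro exI allI impI)
      show "expected_gap_le M f xs x T ((\<Gamma>\<^sup>2 * (A + 2 * L * B) + \<Gamma> * b0) * (1 / real T))"
        if "bounded_adagrad_norm_process M grad xs b0 \<eta> D x g" "second_moment_bound M f grad xs A B 0 x g"
          "1 \<le> T" for M :: "'w measure" and x g T
        using moment_bound[OF norm_run(1)[OF that(1)] that(2) norm_run(2)[OF that(1)]] that nonneg by simp
    qed
    show "\<exists>K. \<forall>(M :: 'w measure) x g. bounded_adagrad_process M grad xs b0v \<eta> Dv x g \<longrightarrow>
        second_moment_bound M f grad xs A B 0 x g \<longrightarrow>
        (\<forall>T\<ge>1. expected_gap_le M f xs x T (K * (1 / real T)))"
    proof (intro exI allI impI)
      show "expected_gap_le M f xs x T ((\<Lambda>\<^sup>2 * (A + 2 * L * B) + \<Lambda> * \<beta>0) * (1 / real T))"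
        if "bounded_adagrad_process M grad xs b0v \<eta> Dv x g" "second_moment_bound M f grad xs A B 0 x g"
          "1 \<le> T" for M :: "'w measure" and x g T
        using moment_bound[OF coord_run(1)[OF that(1)] that(2) coord_run(2)[OF that(1)]] that nonneg by simp
    qed
    show "\<exists>K. \<forall>\<sigma>\<ge>0. \<forall>(M :: 'w measure) x g. bounded_adagrad_norm_process M grad xs b0 \<eta> D x g \<longrightarrow>
        bounded_variance M grad \<sigma> x g \<longrightarrow>
        (\<forall>T\<ge>1. expected_gap_le M f xs x T (K * (1 / real T + \<sigma> / sqrt (real T))))"
      using rate[OF norm_variance] nonneg by blast
    show "\<exists>K. \<forall>\<sigma>\<ge>0. \<forall>(M :: 'w measure) x g. bounded_adagrad_process M grad xs b0v \<eta> Dv x g \<longrightarrow>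
        bounded_variance M grad \<sigma> x g \<longrightarrow>
        (\<forall>T\<ge>1. expected_gap_le M f xs x T (K * (1 / real T + \<sigma> / sqrt (real T))))"
      using rate[OF coord_variance] nonneg by blast
  qed
qed

end
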